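(* Let $K$ be a field, let $\mathcal{F}=K[\alpha,\beta:\alpha^2=\beta^2=0]$ and let $f$ be a Laurent polynomial over $K$. Then the following are equivalent: (1) $f$ is not a Laurent polynomial identity of $\mathcal{U}(\mathcal{F})$. (2) There is a non-zero polynomial $g\in K[T]$ such that every $K$-algebra $B$ for which $f$ is a Laurent polynomial identity of $\mathcal{U}(B)$ has the property $\mathcal{P}_1$ with respect to $g$.
   Context: All algebras are associative with identity. $\mathcal{U}(A)$ denotes the group of units of a $K$-algebra $A$. $\mathcal{F}=K[\alpha,\beta:\alpha^2=\beta^2=0]$ is the quotient of the free associative $K$-algebra on two non-commuting variables $\alpha,\beta$ by the ideal generated by $\alpha^2$ and $\beta^2$. A Laurent polynomial over $K$ is an element of $K\langle X_1^{\pm1},X_2^{\pm1},\dots\rangle$, the group algebra over $K$ of the free group on the countably many generators $X_1,X_2,\dots$. A Laurent polynomial $f$ is a Laurent polynomial identity (LPI) of $\mathcal{U}(A)$ if $f(u_1,u_2,\dots)=0$ for all $u_1,u_2,\dots\in\mathcal{U}(A)$. For a polynomial $g\in K[T]$ in one variable, a $K$-algebra $A$ has the property $\mathcal{P}_1$ with respect to $g$ if $g(ab)=0$ for all $a,b\in A$ with $a^2=0=b^2$. *)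

theory Defs
  imports
    "HOL-Algebra.QuotRing"
    "HOL-Algebra.Module"
    "HOL-Algebra.Algebraic_Closure_Type"
    "HOL-Library.Poly_Mapping"
begin

section \<open>Free groups and Laurent polynomials\<close>

text \<open>
  A letter \<open>(i, True)\<close> stands for the generator \<open>X\<^sub>i\<close> and \<open>(i, False)\<close> for its inverse.
\<close>

inductive cancels :: "('a \<times> bool) list \<Rightarrow> ('a \<times> bool) list \<Rightarrow> bool" where
  "cancels (xs @ (x, s) # (x, \<not> s) # ys) (xs @ ys)"

quotient_type 'a free_group = "('a \<times> bool) list" / "equivclp cancels"
  by (rule equivp_evquivclp)

lemma cancels_context: "cancels v w \<Longrightarrow> cancels (xs @ v @ ys) (xs @ w @ ys)"
proof (induction rule: cancels.induct)
  case (1 as x s bs)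
  show ?case
    using cancels.intros[of "xs @ as" x s "bs @ ys"] by simp
qed

lemma equivclp_cancels_context:
  "equivclp cancels v w \<Longrightarrow> equivclp cancels (xs @ v @ ys) (xs @ w @ ys)"
proof (induction rule: equivclp_induct)
  case (step y z)
  then have "equivclp cancels (xs @ y @ ys) (xs @ z @ ys)"
    by (auto intro: cancels_context r_into_equivclp converse_r_into_equivclp)
  with step.IH show ?case by (rule equivclp_trans)
qed simp

definition inverse_word :: "('a \<times> bool) list \<Rightarrow> ('a \<times> bool) list" where
  "inverse_word w = rev (map (\<lambda>(x, s). (x, \<not> s)) w)"

lemma cancels_inverse_word: "cancels v w \<Longrightarrow> cancels (inverse_word v) (inverse_word w)"
proof (induction rule: cancels.induct)
  case (1 xs x s ys)
  show ?case
    using cancels.intros[of "inverse_word ys" x s "inverse_word xs"]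
    by (simp add: inverse_word_def)
qed

lemma equivclp_cancels_inverse_word:
  "equivclp cancels v w \<Longrightarrow> equivclp cancels (inverse_word v) (inverse_word w)"
proof (induction rule: equivclp_induct)
  case (step y z)
  then have "equivclp cancels (inverse_word y) (inverse_word z)"
    by (auto intro: cancels_inverse_word r_into_equivclp converse_r_into_equivclp)
  with step.IH show ?case by (rule equivclp_trans)
qed simp

lemma inverse_word_append_cancels: "equivclp cancels (inverse_word w @ w) []"
proof (induction w)
  case (Cons a w)
  obtain x s where a: "a = (x, s)" by (cases a)
  have "cancels (inverse_word (a # w) @ a # w) (inverse_word w @ w)"
    using cancels.intros[of "inverse_word w" x "\<not> s" w] by (simp add: inverse_word_def a)
  then show ?case
    by (rule equivclp_trans[OF r_into_equivclp Cons.IH])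
qed (simp add: inverse_word_def)

text \<open>
  The group operation is written additively, because the convolution product of
  \<^typ>\<open>'g \<Rightarrow>\<^sub>0 'k\<close> is defined for a \<^class>\<open>monoid_add\<close> of exponents
  (this class is not commutative).
\<close>

instantiation free_group :: (type) group_add
begin

lift_definition zero_free_group :: "'a free_group" is "[]" .

lift_definition plus_free_group :: "'a free_group \<Rightarrow> 'a free_group \<Rightarrow> 'a free_group"
  is "(@)"
proof -
  fix v v' w w' :: "('a \<times> bool) list"
  assume "equivclp cancels v v'" "equivclp cancels w w'"
  then have "equivclp cancels (v @ w) (v' @ w)" "equivclp cancels (v' @ w) (v' @ w')"
    using equivclp_cancels_context[of v v' "[]" w] equivclp_cancels_context[of w w' v' "[]"]
    by simp_all
  then show "equivclp cancels (v @ w) (v' @ w')"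
    by (rule equivclp_trans)
qed

lift_definition uminus_free_group :: "'a free_group \<Rightarrow> 'a free_group"
  is inverse_word
  by (rule equivclp_cancels_inverse_word)

definition minus_free_group :: "'a free_group \<Rightarrow> 'a free_group \<Rightarrow> 'a free_group" where
  "minus_free_group a b = a + - b"

instance
proof
  fix a b c :: "'a free_group"
  show "a + b + c = a + (b + c)" by transfer simp
  show "0 + a = a" by transfer simp
  show "a + 0 = a" by transfer simp
  show "- a + a = 0" by transfer (rule inverse_word_append_cancels)
  show "a + - b = a - b" by (simp add: minus_free_group_def)
qed

end

text \<open>The group algebra over \<open>'k\<close> of the free group on countably many generators.\<close>

type_synonym 'k laurent_poly = "nat free_group \<Rightarrow>\<^sub>0 'k"


section \<open>Algebras over a field\<close>

text \<open>
  The library locale \<^locale>\<open>algebra\<close> is restricted to commutative algebras. Here the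
  algebra is associative with identity, and not necessarily commutative. The ground field is
  the whole type \<open>'k\<close>, turned into a record by \<^const>\<open>ring_of_type_algebra\<close>.
\<close>

locale unital_algebra =
  module "ring_of_type_algebra :: 'k::field ring" B + ring B
  for B :: "('k::field, 'b, 'm) module_scheme" (structure) +
  assumes smult_mult_left:
      "x \<in> carrier B \<Longrightarrow> y \<in> carrier B \<Longrightarrow> (c \<odot> x) \<otimes> y = c \<odot> (x \<otimes> y)"
    and smult_mult_right:
      "x \<in> carrier B \<Longrightarrow> y \<in> carrier B \<Longrightarrow> x \<otimes> (c \<odot> y) = c \<odot> (x \<otimes> y)"

definition eval_word ::
  "('b, 'm) monoid_scheme \<Rightarrow> ('a \<Rightarrow> 'b) \<Rightarrow> ('a \<times> bool) list \<Rightarrow> 'b" where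
  "eval_word B u w =
     foldr (\<lambda>(i, s) y. (if s then u i else inv\<^bsub>B\<^esub> (u i)) \<otimes>\<^bsub>B\<^esub> y) w \<one>\<^bsub>B\<^esub>"

text \<open>
  The value of a group element is computed on an arbitrary representing word; for units
  \<open>u\<close> the choice is immaterial by \<open>eval_word_cong\<close> below.
\<close>

definition eval_laurent ::
  "('k::field, 'b, 'm) module_scheme \<Rightarrow> (nat \<Rightarrow> 'b) \<Rightarrow> 'k laurent_poly \<Rightarrow> 'b" where
  "eval_laurent B u f =
     (\<Oplus>\<^bsub>B\<^esub>w\<in>Poly_Mapping.keys f.
        Poly_Mapping.lookup f w \<odot>\<^bsub>B\<^esub> eval_word B u (rep_free_group w))"

definition is_LPI :: "'k::field laurent_poly \<Rightarrow> ('k, 'b, 'm) module_scheme \<Rightarrow> bool" where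
  "is_LPI f B \<longleftrightarrow> (\<forall>u. (\<forall>i. u i \<in> Units B) \<longrightarrow> eval_laurent B u f = \<zero>\<^bsub>B\<^esub>)"

definition eval_poly_in ::
  "('k::field, 'b, 'm) module_scheme \<Rightarrow> 'k poly \<Rightarrow> 'b \<Rightarrow> 'b" where
  "eval_poly_in B g x =
     (\<Oplus>\<^bsub>B\<^esub>i\<in>{..Polynomial.degree g}. Polynomial.coeff g i \<odot>\<^bsub>B\<^esub> (x [^]\<^bsub>B\<^esub> i))"

definition property_P1 :: "('k::field, 'b, 'm) module_scheme \<Rightarrow> 'k poly \<Rightarrow> bool" where
  "property_P1 B g \<longleftrightarrow>
     (\<forall>a\<in>carrier B. \<forall>b\<in>carrier B.
        a \<otimes>\<^bsub>B\<^esub> a = \<zero>\<^bsub>B\<^esub> \<and> b \<otimes>\<^bsub>B\<^esub> b = \<zero>\<^bsub>B\<^esub> \<longrightarrow>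
        eval_poly_in B g (a \<otimes>\<^bsub>B\<^esub> b) = \<zero>\<^bsub>B\<^esub>)"

context monoid
begin

lemma eval_word_Nil: "eval_word G u [] = \<one>"
  by (simp add: eval_word_def)

lemma eval_word_Cons:
  "eval_word G u ((i, s) # w) = (if s then u i else inv (u i)) \<otimes> eval_word G u w"
  by (simp add: eval_word_def)

context
  fixes u :: "'i \<Rightarrow> 'a"
  assumes u: "\<And>i. u i \<in> Units G"
begin

lemma letter_closed: "(if s then u i else inv (u i)) \<in> carrier G"
  using Units_closed[OF u] Units_inv_closed[OF u] by simp

lemma eval_word_closed: "eval_word G u w \<in> carrier G"
proof (induction w)
  case (Cons a w)
  then show ?case
    by (cases a) (simp only: eval_word_Cons letter_closed m_closed)
qed (simp add: eval_word_Nil)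

lemma eval_word_append: "eval_word G u (v @ w) = eval_word G u v \<otimes> eval_word G u w"
proof (induction v)
  case Nil
  show ?case by (simp add: eval_word_Nil eval_word_closed)
next
  case (Cons a v)
  then show ?case
    by (cases a)
      (simp only: append_Cons eval_word_Cons m_assoc letter_closed eval_word_closed)
qed

lemma eval_word_cancels:
  assumes "cancels v w"
  shows "eval_word G u v = eval_word G u w"
  using assms
proof cases
  case (1 xs x s ys)
  have *: "eval_word G u [(x, s), (x, \<not> s)] = \<one>"
    using u[of x] Units_closed[OF u, of x] by (cases s) (simp_all add: eval_word_Cons eval_word_Nil)
  have "eval_word G u v = eval_word G u (xs @ [(x, s), (x, \<not> s)] @ ys)"
    unfolding 1 by simp
  also have "\<dots> = eval_word G u xs \<otimes> (eval_word G u [(x, s), (x, \<not> s)] \<otimes> eval_word G u ys)"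
    by (simp only: eval_word_append)
  also have "\<dots> = eval_word G u xs \<otimes> eval_word G u ys"
    unfolding * by (simp add: eval_word_closed)
  also have "\<dots> = eval_word G u w"
    unfolding 1 by (simp only: eval_word_append)
  finally show ?thesis .
qed

lemma eval_word_cong:
  assumes "equivclp cancels v w"
  shows "eval_word G u v = eval_word G u w"
  using assms
proof (induction rule: equivclp_induct)
  case (step y z)
  then show ?case by (auto dest: eval_word_cancels)
qed simp

end

end


section \<open>The algebra generated by two elements of square zero\<close>

datatype gen = Alpha | Beta

typedef free_monoid = "UNIV :: gen list set"
  morphisms letters word by simp

setup_lifting type_definition_free_monoid

text \<open>
  Words are concatenated by \<open>+\<close>, again in order to use the convolution product.
\<close>

instantiation free_monoid :: monoid_add
begin

lift_definition zero_free_monoid :: free_monoid is "[]" .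
lift_definition plus_free_monoid :: "free_monoid \<Rightarrow> free_monoid \<Rightarrow> free_monoid" is "(@)" .

instance
  by standard (transfer; simp)+

end

text \<open>The free associative algebra on two non-commuting variables.\<close>

type_synonym 'k free_algebra = "free_monoid \<Rightarrow>\<^sub>0 'k"

definition gen_alpha :: "'k::field free_algebra" where
  "gen_alpha = Poly_Mapping.single (word [Alpha]) 1"

definition gen_beta :: "'k::field free_algebra" where
  "gen_beta = Poly_Mapping.single (word [Beta]) 1"

abbreviation scale_fa :: "'k::field \<Rightarrow> 'k free_algebra \<Rightarrow> 'k free_algebra" where
  "scale_fa c \<equiv> Poly_Mapping.map ((*) c)"

definition square_ideal :: "'k::field free_algebra set" where
  "square_ideal = Idl\<^bsub>ring_of_type_algebra\<^esub> {gen_alpha\<^sup>2, gen_beta\<^sup>2}"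

text \<open>
  The quotient ring, with the scalar action induced on cosets in the style of
  \<^const>\<open>rcoset_mult\<close>.
\<close>

definition algF :: "('k::field, 'k free_algebra set) module" where
  "algF = ring.extend (ring_of_type_algebra Quot square_ideal)
     (module.fields
       (\<lambda>c A. \<Union>x\<in>A. square_ideal +>\<^bsub>ring_of_type_algebra\<^esub> scale_fa c x))"

lemma ring_ring_of_type_algebra: "ring (ring_of_type_algebra :: 'a::ring_1 ring)"
proof -
  have "\<exists>y. x + y = 0" for x :: 'a by (rule exI[of _ "-x"]) simp
  moreover have "\<exists>y. y + x = 0 \<and> x + y = 0" for x :: 'a by (rule exI[of _ "-x"]) simp
  ultimately show ?thesis unfolding ring_of_type_algebra_def
    by unfold_locales (auto simp: algebra_simps Units_def)
qed

lemma scale_fa_eq: "scale_fa c x = Poly_Mapping.single 0 c * x"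
proof (rule poly_mapping_eqI)
  fix k
  have "Poly_Mapping.lookup (Poly_Mapping.single 0 c * x) k = c * Poly_Mapping.lookup x k"
    by (simp add: mult.left_commute lookup_mult lookup_single mult_when when_mult)
  then show "Poly_Mapping.lookup (scale_fa c x) k = Poly_Mapping.lookup (Poly_Mapping.single 0 c * x) k"
    by (simp add: map.rep_eq when_def)
qed

lemma mult_scale_fa: "x * scale_fa c y = scale_fa c (x * y)"
proof -
  have "x * Poly_Mapping.single 0 c = Poly_Mapping.single 0 c * x"
  proof (rule poly_mapping_eqI)
    fix k :: free_monoid
    have "(\<Sum>aa. c when aa = 0 when k = a + aa) = (c when k = a)" for a
    proof -
      have "(c when aa = 0 when k = a + aa) = ((c when k = a) when aa = 0)" for aa
        by (cases "aa = 0") simp_all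
      then show ?thesis by simp
    qed
    then show "Poly_Mapping.lookup (x * Poly_Mapping.single 0 c) k = Poly_Mapping.lookup (Poly_Mapping.single 0 c * x) k"
      by (simp add: lookup_mult lookup_single mult_when when_mult mult.commute)
  qed
  then show ?thesis unfolding scale_fa_eq by (metis mult.assoc)
qed

lemma unital_algebra_algF: "unital_algebra (algF :: ('k::field, 'k free_algebra set) module)"
proof -
  let ?R = "ring_of_type_algebra :: 'k free_algebra ring"
  interpret R: ring ?R by (rule ring_ring_of_type_algebra)
  interpret I: ideal "square_ideal :: 'k free_algebra set" ?R
    unfolding square_ideal_def by (rule R.genideal_ideal) (simp add: ring_of_type_algebra_def)
  let ?I = "square_ideal :: 'k free_algebra set"
  let ?Q = "?R Quot ?I"
  let ?F = "algF :: ('k, 'k free_algebra set) module"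
  interpret Q: ring ?Q by (rule I.quotient_is_ring)
  have simps: "carrier ?F = carrier ?Q" "monoid.mult ?F = monoid.mult ?Q" "one ?F = one ?Q" "add ?F = add ?Q" "zero ?F = zero ?Q"
    by (simp_all add: algF_def ring.defs FactRing_def)
  have carr: "carrier ?R = UNIV" by (simp add: ring_of_type_algebra_def)
  have mul: "monoid.mult ?R = (*)" "add ?R = (+)" "one ?R = 1" by (auto simp add: ring_of_type_algebra_def)
  have sm_I: "scale_fa c x \<in> ?I" if "x \<in> ?I" for c x
    using I.I_l_closed[OF that, of "Poly_Mapping.single 0 c"] by (simp add: carr mul scale_fa_eq)
  have cos: "?I +>\<^bsub>?R\<^esub> x = {i + x |i. i \<in> ?I}" for x by (auto simp: a_r_coset_def' mul)
  have sm_add: "scale_fa c (x + y) = scale_fa c x + scale_fa c y" for c :: 'k and x y by (simp add: scale_fa_eq distrib_left)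
  have s: "module.smult ?F c (?I +>\<^bsub>?R\<^esub> x) = ?I +>\<^bsub>?R\<^esub> (scale_fa c x)" for c x
  proof -
    have "?I +>\<^bsub>?R\<^esub> (scale_fa c y) = ?I +>\<^bsub>?R\<^esub> (scale_fa c x)" if "y \<in> ?I +>\<^bsub>?R\<^esub> x" for y
    proof -
      from that obtain i where i: "i \<in> ?I" "y = i + x" by (auto simp: cos)
      have "scale_fa c y \<in> ?I +>\<^bsub>?R\<^esub> scale_fa c x" using i sm_I by (auto simp: cos sm_add)
      then show ?thesis using I.a_repr_independence'[of "scale_fa c y" "scale_fa c x"] carr by simp
    qed
    moreover have "x \<in> ?I +>\<^bsub>?R\<^esub> x" using I.a_rcos_self carr by blast
    moreover have "module.smult ?F c A = (\<Union>y\<in>A. ?I +>\<^bsub>?R\<^esub> (scale_fa c y))" for A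
      by (simp add: algF_def module.defs ring.defs)
    ultimately show ?thesis by blast
  qed
  have Qc: "carrier ?Q = range (\<lambda>x. ?I +>\<^bsub>?R\<^esub> x)" by (auto simp: FactRing_def A_RCOSETS_def RCOSETS_def a_r_coset_def carr)
  have Qa: "(?I +>\<^bsub>?R\<^esub> x) \<oplus>\<^bsub>?Q\<^esub> (?I +>\<^bsub>?R\<^esub> y) = ?I +>\<^bsub>?R\<^esub> (x + y)" for x y
    using I.a_rcos_sum[of x y] by (simp add: FactRing_def carr mul)
  have Qm: "(?I +>\<^bsub>?R\<^esub> x) \<otimes>\<^bsub>?Q\<^esub> (?I +>\<^bsub>?R\<^esub> y) = ?I +>\<^bsub>?R\<^esub> (x * y)" for x y
    using I.rcoset_mult_add[of x y] by (simp add: FactRing_def carr mul)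
  have ringF: "ring ?F"
    apply (intro ringI abelian_groupI monoidI) unfolding simps
    apply (simp_all add: Q.a_ac Q.m_assoc Q.l_distr Q.r_distr)
    done
  interpret F: ring ?F by (rule ringF)
  interpret K: cring "ring_of_type_algebra :: 'k ring" by (rule cring_from_type_algebra)
  have kc: "monoid.mult (ring_of_type_algebra :: 'k ring) = (*)" "add (ring_of_type_algebra :: 'k ring) = (+)" "one (ring_of_type_algebra :: 'k ring) = 1"
    by (auto simp: ring_of_type_algebra_def)
  show ?thesis
  proof (unfold_locales, goal_cases)
    case (1 a x) then show ?case by (auto simp: simps Qc s)
  next
    case (2 a b x) then show ?case by (auto simp: simps Qc s Qa kc scale_fa_eq single_add distrib_right)
  next
    case (3 a x y) then show ?case by (auto simp: simps Qc s Qa kc scale_fa_eq distrib_left)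
  next
    case (4 a b x) 
    have "scale_fa (a*b) y = scale_fa a (scale_fa b y)" for y by (simp add: scale_fa_eq mult_single mult.assoc[symmetric])
    then show ?case using 4 by (auto simp: simps Qc s kc)
  next
    case (5 x) then show ?case by (auto simp: simps Qc s kc scale_fa_eq)
  next
    case (6 x y c) then show ?case by (auto simp: simps Qc s Qm scale_fa_eq mult.assoc)
  next
    case (7 x y c) then show ?case by (auto simp: simps Qc s Qm mult_scale_fa)
  qed
qed

text \<open>
  A quantifier over all algebras ranges over the algebras with carrier in a given type. The
  statement ``every algebra \<open>B\<close> with a given identity has property \<open>P\<^sub>1\<close> with
  respect to \<open>g\<close>'' is therefore formulated for carriers in \<^typ>\<open>'k free_algebra set\<close>,
  where \<^const>\<open>algF\<close> and up to isomorphism every algebra generated by two elements can be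
  found, together with the assertion that, for each \<open>g\<close>, this already implies the same for
  carriers in an arbitrary type. Hence \<open>g\<close> does not depend on the type of \<open>B\<close>.
\<close>

end

theory Submission
  imports Defs
begin

text \<open>
  The ideal generated by the two squares consists of the elements supported on words with two
  equal adjacent letters, so the alternating words form a basis of \<open>\<F>\<close>; in particular
  \<open>\<alpha>\<beta>\<close> is transcendental, and no non-zero \<open>g\<close> has \<open>g(\<alpha>\<beta>) = 0\<close>.
  Conversely, let \<open>x = f(u) \<noteq> 0\<close> in \<open>\<F>\<close>. An alternating word in the support of \<open>x\<close>
  extends to a power of \<open>\<alpha>\<beta>\<close>, and the words \<open>s\<close>, \<open>t\<close> added on the left and on
  the right turn \<open>x\<close> into \<open>s x t = g(\<alpha>\<beta>)\<close> with \<open>g \<noteq> 0\<close>, because an alternating word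
  that begins with \<open>\<alpha>\<close> and ends with \<open>\<beta>\<close> is a power of \<open>\<alpha>\<beta>\<close>. If \<open>f\<close> is an
  identity of \<open>\<U>(B)\<close>, the homomorphism from \<open>\<F>\<close> to \<open>B\<close> with \<open>\<alpha> \<mapsto> a\<close>,
  \<open>\<beta> \<mapsto> b\<close> kills \<open>x\<close>, hence \<open>g(ab) = 0\<close>.
\<close>

section \<open>Finitely supported functions and words\<close>

lemma update_eq_add_single:
  fixes x :: "'a \<Rightarrow>\<^sub>0 'b::monoid_add"
  shows "w \<notin> Poly_Mapping.keys x \<Longrightarrow> Poly_Mapping.update w c x = x + Poly_Mapping.single w c"
  by (intro poly_mapping_eqI)
    (auto simp: lookup_update lookup_add lookup_single in_keys_iff when_def)

text \<open>Meant for claims additive in x, such as multiplicativity of \<open>subst\<close>: only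
  monomials remain to be checked. The two summands may cancel, so it does not suit claims about
  supports.\<close>

lemma poly_mapping_add_induct [case_names zero single add]:
  fixes x :: "'a \<Rightarrow>\<^sub>0 'b::monoid_add"
  assumes "P 0" "\<And>w c. P (Poly_Mapping.single w c)"
    and "\<And>x y. P x \<Longrightarrow> P y \<Longrightarrow> P (x + y)"
  shows "P x"
proof (induction x rule: update_induct)
  case const
  then show ?case using assms(1) by simp
next
  case (update f a b)
  then show ?case using assms(2,3) by (simp add: update_eq_add_single)
qed

lemma not_distinct_adjE:
  assumes "\<not> distinct_adj xs"
  obtains us x vs where "xs = us @ [x, x] @ vs"
proof -
  obtain i where i: "Suc i < length xs" "xs ! i = xs ! Suc i"
    using assms unfolding distinct_adj_conv_nth by blast
  then have "xs = take i xs @ [xs ! i, xs ! i] @ drop (Suc (Suc i)) xs"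
    by (metis Cons_nth_drop_Suc Suc_lessD append.simps id_take_nth_drop)
  then show thesis by (rule that)
qed

lemma letters_word [simp]: "letters (word w) = w"
  by (simp add: word_inverse)

lemma letters_plus [simp]: "letters (v + w) = letters v @ letters w"
  by (simp add: plus_free_monoid.rep_eq)

lemma letters_zero [simp]: "letters 0 = []"
  by (simp add: zero_free_monoid.rep_eq)

lemma word_append: "word (v @ w) = word v + word w"
  by (metis letters_inverse letters_plus word_inverse UNIV_I)

lemma word_Nil: "word [] = 0"
  by (simp add: zero_free_monoid_def)


section \<open>The free algebra and its quotients\<close>

abbreviation free_alg_ring :: "'k::field free_algebra ring" where
  "free_alg_ring \<equiv> ring_of_type_algebra"

abbreviation monomial :: "gen list \<Rightarrow> 'k::field free_algebra" where
  "monomial w \<equiv> Poly_Mapping.single (word w) 1"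

lemma single_eq_scale: "Poly_Mapping.single w c = scale_fa c (Poly_Mapping.single w 1)"
  by (simp add: scale_fa_eq mult_single)

lemma scale_fa_simps:
  "scale_fa (c + d) x = scale_fa c x + scale_fa d x"
  "scale_fa c (x + y) = scale_fa c x + scale_fa c y"
  "scale_fa (c * d) x = scale_fa c (scale_fa d x)"
  "scale_fa 1 x = x"
  "scale_fa c x * y = scale_fa c (x * y)"
  "x * scale_fa c y = scale_fa c (x * y)"
proof -
  show "x * scale_fa c y = scale_fa c (x * y)" by (rule mult_scale_fa)
  have "Poly_Mapping.single (0 :: free_monoid) (c * d) =
      Poly_Mapping.single 0 c * Poly_Mapping.single 0 d"
    by (simp add: mult_single)
  then show "scale_fa (c * d) x = scale_fa c (scale_fa d x)"
    by (simp only: scale_fa_eq mult.assoc)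
qed (simp_all add: scale_fa_eq single_add distrib_left distrib_right mult.assoc)

lemma ring_of_type_algebra_simps [simp]:
  "carrier ring_of_type_algebra = UNIV" "x \<otimes>\<^bsub>ring_of_type_algebra\<^esub> y = x * y"
  "x \<oplus>\<^bsub>ring_of_type_algebra\<^esub> y = x + y" "\<one>\<^bsub>ring_of_type_algebra\<^esub> = 1"
  "\<zero>\<^bsub>ring_of_type_algebra\<^esub> = 0"
  by (simp_all add: ring_of_type_algebra_def)

text \<open>The ideal is kept general because two are used: \<open>square_ideal\<close>, which gives
  \<open>algF\<close>, and the kernel of a substitution, which gives a copy of a two-generated
  subalgebra.\<close>

definition quot_algebra ::
  "'k::field free_algebra set \<Rightarrow> ('k, 'k free_algebra set) module" where
  "quot_algebra I = ring.extend (free_alg_ring Quot I)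
     (module.fields (\<lambda>c A. \<Union>x\<in>A. I +>\<^bsub>free_alg_ring\<^esub> scale_fa c x))"

lemma algF_eq: "algF = quot_algebra square_ideal"
  by (simp add: algF_def quot_algebra_def)

lemma ring_of_type_algebra_a_inv [simp]:
  "\<ominus>\<^bsub>ring_of_type_algebra\<^esub> (x :: 'a::ring_1) = - x"
  using abelian_group.minus_equality[OF ring.is_abelian_group[OF ring_ring_of_type_algebra], of "- x" x]
  by simp

locale free_algebra_ideal = ideal I "free_alg_ring :: 'k::field free_algebra ring" for I
begin

abbreviation cls :: "'k free_algebra \<Rightarrow> 'k free_algebra set" where
  "cls x \<equiv> I +>\<^bsub>free_alg_ring\<^esub> x"

abbreviation quot :: "('k, 'k free_algebra set) module" where
  "quot \<equiv> quot_algebra I"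

lemma cls_eq_iff: "cls x = cls y \<longleftrightarrow> x - y \<in> I"
  using quotient_eq_iff_same_a_r_cos[OF is_ideal, of x y] by (simp add: a_minus_def)

lemma mem_cls_self: "x \<in> cls x"
  using a_rcos_self[of x] by simp

lemma mem_cls_iff: "y \<in> cls x \<longleftrightarrow> y - x \<in> I"
  by (metis a_repr_independence' cls_eq_iff mem_cls_self ring_of_type_algebra_simps(1) UNIV_I)

lemma scale_closed: "x \<in> I \<Longrightarrow> scale_fa c x \<in> I"
  using I_l_closed[of x "Poly_Mapping.single 0 c"] by (simp add: scale_fa_eq)

text \<open>The ideal is stable under scalars, so all representatives of a coset scale into one
  coset and the union in \<open>quot_algebra\<close> collapses.\<close>

lemma cls_smult: "c \<odot>\<^bsub>quot\<^esub> cls x = cls (scale_fa c x)"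
proof -
  have "cls (scale_fa c y) = cls (scale_fa c x)" if "y \<in> cls x" for y
    using that scale_closed[of "y - x" c]
    by (simp add: mem_cls_iff cls_eq_iff scale_fa_eq right_diff_distrib)
  then have "(\<Union>y\<in>cls x. cls (scale_fa c y)) = cls (scale_fa c x)"
    using mem_cls_self by blast
  then show ?thesis by (simp add: quot_algebra_def module.defs ring.defs)
qed

lemma carrier_quot: "carrier quot = range cls"
  by (auto simp: quot_algebra_def ring.defs FactRing_def A_RCOSETS_def RCOSETS_def a_r_coset_def)

lemma cls_mem_carrier: "cls x \<in> carrier quot"
  by (simp add: carrier_quot)

lemma cls_mult: "cls x \<otimes>\<^bsub>quot\<^esub> cls y = cls (x * y)"
  using rcoset_mult_add[of x y] by (simp add: quot_algebra_def ring.defs FactRing_def)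

lemma cls_add: "cls x \<oplus>\<^bsub>quot\<^esub> cls y = cls (x + y)"
  using a_rcos_sum[of x y] by (simp add: quot_algebra_def ring.defs FactRing_def)

lemma cls_one: "\<one>\<^bsub>quot\<^esub> = cls 1"
  by (simp add: quot_algebra_def ring.defs FactRing_def)

lemma cls_zero: "\<zero>\<^bsub>quot\<^esub> = cls 0"
  using a_rcos_zero[OF is_ideal, of 0] additive_subgroup.zero_closed[OF is_additive_subgroup]
  by (simp add: quot_algebra_def ring.defs FactRing_def)

lemmas cls_simps = cls_mult cls_add cls_one cls_zero cls_smult

lemma cls_eq_zero_iff: "cls x = \<zero>\<^bsub>quot\<^esub> \<longleftrightarrow> x \<in> I"
  by (simp add: cls_zero cls_eq_iff)

lemma unital_algebra_quot: "unital_algebra quot"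
proof -
  have "\<exists>y\<in>carrier quot. y \<oplus>\<^bsub>quot\<^esub> x = \<zero>\<^bsub>quot\<^esub>" if x: "x \<in> carrier quot" for x
  proof -
    obtain z where z: "x = cls z" using x by (auto simp: carrier_quot)
    have "cls (- z) \<oplus>\<^bsub>quot\<^esub> x = \<zero>\<^bsub>quot\<^esub>" by (simp add: z cls_simps)
    then show ?thesis using cls_mem_carrier by blast
  qed
  then interpret Q: ring quot
    by (intro ringI abelian_groupI monoidI)
      (auto simp: carrier_quot cls_simps algebra_simps)
  interpret K: cring "ring_of_type_algebra :: 'k ring"
    by (rule cring_from_type_algebra)
  show ?thesis
    by unfold_locales
      (auto simp: carrier_quot cls_simps scale_fa_simps)
qed

end


section \<open>Homomorphisms of algebras\<close>

locale unital_algebra_hom = A: unital_algebra A + B: unital_algebra B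
  for A :: "('k::field, 'a, 'm) module_scheme" and B :: "('k, 'b, 'n) module_scheme" +
  fixes h :: "'a \<Rightarrow> 'b"
  assumes hom: "h \<in> ring_hom A B"
    and hom_smult: "x \<in> carrier A \<Longrightarrow> h (c \<odot>\<^bsub>A\<^esub> x) = c \<odot>\<^bsub>B\<^esub> h x"

sublocale unital_algebra_hom \<subseteq> ring_hom_ring A B h
  by unfold_locales (rule hom)

context unital_algebra
begin

lemma scale_closed [simp]: "x \<in> carrier B \<Longrightarrow> c \<odot> x \<in> carrier B"
  by (rule smult_closed) simp_all

lemma scale_add: "x \<in> carrier B \<Longrightarrow> (c + d) \<odot> x = c \<odot> x \<oplus> d \<odot> x"
  using smult_l_distr[of c d x] by simp

lemma scale_scale: "x \<in> carrier B \<Longrightarrow> (c * d) \<odot> x = c \<odot> (d \<odot> x)"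
  using smult_assoc1[of c d x] by simp

lemma scale_left_commute: "x \<in> carrier B \<Longrightarrow> c \<odot> (d \<odot> x) = d \<odot> (c \<odot> x)"
  by (metis mult.commute scale_scale)

lemma scale_zero: "x \<in> carrier B \<Longrightarrow> 0 \<odot> x = \<zero>"
  using scale_add[of x 0 0] scale_closed[of x 0] by (metis add.r_cancel_one add_0)

end

context unital_algebra_hom
begin

text \<open>The image of the inverse is a two-sided inverse of the image. This makes homomorphisms
  compatible with words that contain inverse letters.\<close>

lemma hom_Units:
  assumes "x \<in> Units A"
  shows "h x \<in> Units B" "h (inv\<^bsub>A\<^esub> x) = inv\<^bsub>B\<^esub> h x"
proof -
  have x: "x \<in> carrier A" "inv\<^bsub>A\<^esub> x \<in> carrier A" using assms by auto
  have "h x \<otimes>\<^bsub>B\<^esub> h (inv\<^bsub>A\<^esub> x) = \<one>\<^bsub>B\<^esub>" "h (inv\<^bsub>A\<^esub> x) \<otimes>\<^bsub>B\<^esub> h x = \<one>\<^bsub>B\<^esub>"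
    using assms x by (simp_all flip: hom_mult)
  with x show "h x \<in> Units B" "h (inv\<^bsub>A\<^esub> x) = inv\<^bsub>B\<^esub> h x"
    by (auto simp: Units_def intro!: B.inv_unique')
qed

lemma hom_eval_word:
  assumes "\<And>i. u i \<in> Units A"
  shows "h (eval_word A u w) = eval_word B (h \<circ> u) w"
proof (induction w)
  case Nil
  show ?case by (simp add: A.eval_word_Nil B.eval_word_Nil)
next
  case (Cons l w)
  obtain i s where l: "l = (i, s)" by (cases l)
  have "eval_word A u w \<in> carrier A" by (rule A.eval_word_closed) (rule assms)
  moreover have "u i \<in> carrier A" using assms by (rule A.Units_closed)
  ultimately show ?case
    using Cons.IH assms by (simp add: l A.eval_word_Cons B.eval_word_Cons hom_Units)
qed

lemma hom_eval_laurent: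
  assumes "\<And>i. u i \<in> Units A"
  shows "h (eval_laurent A u f) = eval_laurent B (h \<circ> u) f"
proof -
  have w: "eval_word A u w \<in> carrier A" for w by (rule A.eval_word_closed) (rule assms)
  have "eval_word B (h \<circ> u) w \<in> carrier B" for w
    unfolding hom_eval_word[OF assms, symmetric] by (rule hom_closed) (rule w)
  with w show ?thesis
    unfolding eval_laurent_def
    by (subst hom_finsum) (auto simp: hom_smult hom_eval_word assms intro!: B.finsum_cong')
qed

lemma hom_eval_poly_in:
  assumes "x \<in> carrier A"
  shows "h (eval_poly_in A g x) = eval_poly_in B g (h x)"
  unfolding eval_poly_in_def
  using assms by (subst hom_finsum) (auto simp: hom_smult hom_nat_pow intro!: B.finsum_cong')

text \<open>Units go to units, so h sends every value of f at units of A to zero, and injectivity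
  brings this back to A.\<close>

lemma is_LPI_of_inj:
  assumes "is_LPI f B" "inj_on h (carrier A)"
  shows "is_LPI f A"
  unfolding is_LPI_def
proof (intro allI impI)
  fix u :: "nat \<Rightarrow> 'a" assume u: "\<forall>i. u i \<in> Units A"
  then have "h (eval_laurent A u f) = \<zero>\<^bsub>B\<^esub>"
    using assms(1) hom_Units by (simp add: hom_eval_laurent is_LPI_def)
  moreover have "eval_laurent A u f \<in> carrier A"
    unfolding eval_laurent_def using u A.eval_word_closed[of u] by (auto intro!: A.finsum_closed)
  ultimately show "eval_laurent A u f = \<zero>\<^bsub>A\<^esub>"
    using assms(2) by (metis A.zero_closed hom_zero inj_onD)
qed

end

section \<open>Substitution into the free algebra\<close>

text \<open>The word of the power (\<alpha>\<beta>)^m.\<close>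

definition alt_word :: "nat \<Rightarrow> gen list" where
  "alt_word m = concat (replicate m [Alpha, Beta])"

text \<open>This is g(\<alpha>\<beta>), expanded in the basis of words so that its coefficients can
  be read off.\<close>

definition poly_alpha_beta :: "'k::field poly \<Rightarrow> 'k free_algebra" where
  "poly_alpha_beta g =
     (\<Sum>m\<le>Polynomial.degree g. Poly_Mapping.single (word (alt_word m)) (Polynomial.coeff g m))"

locale algebra_pair = unital_algebra B
  for B :: "('k::field, 'b, 'm) module_scheme" (structure) +
  fixes a b :: 'b
  assumes a_closed [simp]: "a \<in> carrier B" and b_closed [simp]: "b \<in> carrier B"
begin

definition word_val :: "gen list \<Rightarrow> 'b" where
  "word_val w = foldr (\<lambda>g y. case_gen a b g \<otimes> y) w \<one>"

text \<open>The homomorphism from the free algebra with \<alpha> \<mapsto> a and \<beta> \<mapsto>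
  b. The squares of a and b are arbitrary here.\<close>

definition subst :: "'k free_algebra \<Rightarrow> 'b" where
  "subst x = (\<Oplus>w\<in>Poly_Mapping.keys x. Poly_Mapping.lookup x w \<odot> word_val (letters w))"

lemma word_val_Nil [simp]: "word_val [] = \<one>"
  by (simp add: word_val_def)

lemma word_val_Cons [simp]: "word_val (g # w) = case_gen a b g \<otimes> word_val w"
  by (simp add: word_val_def)

lemma gen_closed [simp]: "case_gen a b g \<in> carrier B"
  by (cases g) simp_all

lemma word_val_closed [simp]: "word_val w \<in> carrier B"
  by (induction w) simp_all

lemma word_val_append: "word_val (v @ w) = word_val v \<otimes> word_val w"
  by (induction v) (simp_all add: m_assoc)

text \<open>Words outside the support contribute zero, so sums over different supports can be
  brought to a common index set, as \<open>subst_add\<close> requires.\<close>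

lemma subst_superset:
  assumes "finite S" "Poly_Mapping.keys x \<subseteq> S"
  shows "subst x = (\<Oplus>w\<in>S. Poly_Mapping.lookup x w \<odot> word_val (letters w))"
  unfolding subst_def using assms
  by (intro add.finprod_mono_neutral_cong_left) (auto simp: in_keys_iff scale_zero)

lemma subst_closed [simp]: "subst x \<in> carrier B"
  unfolding subst_def by (intro finsum_closed) auto

lemma subst_zero [simp]: "subst 0 = \<zero>"
  by (simp add: subst_def)

lemma subst_single: "subst (Poly_Mapping.single w c) = c \<odot> word_val (letters w)"
  by (subst subst_superset[of "{w}"]) (auto simp: lookup_single)

lemma subst_add: "subst (x + y) = subst x \<oplus> subst y"
proof -
  let ?S = "Poly_Mapping.keys x \<union> Poly_Mapping.keys y"
  have "subst (x + y) = (\<Oplus>w\<in>?S. Poly_Mapping.lookup (x + y) w \<odot> word_val (letters w))"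
    by (rule subst_superset) (simp_all add: keys_add)
  also have "\<dots> = (\<Oplus>w\<in>?S. Poly_Mapping.lookup x w \<odot> word_val (letters w)
      \<oplus> Poly_Mapping.lookup y w \<odot> word_val (letters w))"
    by (intro finsum_cong') (auto simp: lookup_add scale_add)
  also have "\<dots> = subst x \<oplus> subst y"
    by (subst finsum_addf) (auto simp: subst_superset[of ?S])
  finally show ?thesis .
qed

text \<open>Both sides are additive in x and in y, so monomials suffice. There words concatenate and
  the scalars move to the front.\<close>

lemma subst_mult: "subst (x * y) = subst x \<otimes> subst y"
proof (induction x rule: poly_mapping_add_induct)
  case (single v c)
  show ?case
  proof (induction y rule: poly_mapping_add_induct)
    case (single w d)
    show ?case
      by (simp add: mult_single subst_single word_val_append smult_mult_left smult_mult_right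
          scale_scale scale_left_commute)
  next
    case (add y z)
    then show ?case by (simp add: distrib_left subst_add r_distr)
  qed simp
next
  case (add x z)
  then show ?case by (simp add: distrib_right subst_add l_distr)
qed simp

lemma subst_one [simp]: "subst 1 = \<one>"
  using subst_single[of 0 1] smult_one[of \<one>] by simp

lemma subst_scale: "subst (scale_fa c x) = c \<odot> subst x"
  by (simp add: scale_fa_eq subst_mult subst_single smult_mult_left)

lemma ring_hom_ring_subst: "ring_hom_ring free_alg_ring B subst"
  by (intro ring_hom_ringI ring_ring_of_type_algebra ring_axioms)
    (simp_all add: subst_mult subst_add)

lemma subst_sum: "subst (sum F S) = (\<Oplus>i\<in>S. subst (F i))" if "finite S"
  using that by induction (simp_all add: subst_add)

lemma word_val_alt_word: "word_val (alt_word m) = (a \<otimes> b) [^] m"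
proof (induction m)
  case (Suc m)
  then show ?case
    using nat_pow_Suc2[of "a \<otimes> b" m] by (simp add: alt_word_def m_assoc)
qed (simp add: alt_word_def)

lemma subst_poly_alpha_beta: "subst (poly_alpha_beta g) = eval_poly_in B g (a \<otimes> b)"
  by (simp add: poly_alpha_beta_def eval_poly_in_def subst_sum subst_single word_val_alt_word)

end

section \<open>Descent of a substitution to a quotient of the free algebra\<close>

locale algebra_pair_ideal = algebra_pair B a b + Q: free_algebra_ideal I
  for B :: "('k::field, 'b, 'm) module_scheme" (structure) and a b and I :: "'k free_algebra set" +
  assumes subst_ideal: "x \<in> I \<Longrightarrow> subst x = \<zero>"
begin

text \<open>Since \<open>subst\<close> kills I, it is constant on each coset; the image of a coset
  is a singleton and \<open>the_elem\<close> extracts its element.\<close>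

definition induced :: "'k free_algebra set \<Rightarrow> 'b" where
  "induced S = the_elem (subst ` S)"

lemma induced_cls: "induced (Q.cls x) = subst x"
proof -
  have "subst y = subst x" if "y \<in> Q.cls x" for y
  proof -
    have "subst (y - x) = \<zero>" using that by (simp only: Q.mem_cls_iff subst_ideal)
    then show ?thesis using subst_add[of "y - x" x] by simp
  qed
  then show ?thesis
    unfolding induced_def by (intro the_elem_image_unique) (use Q.mem_cls_self in blast)+
qed

lemma induced_hom: "unital_algebra_hom Q.quot B induced"
proof -
  interpret quot: unital_algebra Q.quot by (rule Q.unital_algebra_quot)
  show ?thesis
    by unfold_locales
      (auto simp: ring_hom_def Q.carrier_quot Q.cls_simps induced_cls subst_mult subst_add subst_scale)
qed

end

section \<open>Alternating words\<close>

text \<open>Prefixing a fixed word is injective, so multiplication by a monomial moves coefficients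
  without merging any.\<close>

lemma lookup_monomial_mult: "Poly_Mapping.lookup (monomial s * x) (word s + w) = Poly_Mapping.lookup x w"
proof -
  have "word s + v = word s + w \<longleftrightarrow> v = w" for v
    by (metis letters_inject letters_plus same_append_eq)
  then show ?thesis
    by (induction x rule: poly_mapping_add_induct)
      (simp_all add: mult_single lookup_single lookup_add distrib_left)
qed

lemma lookup_mult_monomial: "Poly_Mapping.lookup (x * monomial t) (w + word t) = Poly_Mapping.lookup x w"
proof -
  have "v + word t = w + word t \<longleftrightarrow> v = w" for v
    by (metis letters_inject letters_plus append_same_eq)
  then show ?thesis
    by (induction x rule: poly_mapping_add_induct)
      (simp_all add: mult_single lookup_single lookup_add distrib_right)
qed

section \<open>The ideal of the two squares, described by supports\<close>

lemma ideal_square_ideal: "ideal (square_ideal :: 'k::field free_algebra set) ring_of_type_algebra"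
  unfolding square_ideal_def by (rule ring.genideal_ideal[OF ring_ring_of_type_algebra]) simp

lemma free_algebra_ideal_square_ideal:
  "free_algebra_ideal (square_ideal :: 'k::field free_algebra set)"
  by (intro free_algebra_ideal.intro ideal_square_ideal)

lemma square_mem_square_ideal: "monomial [g, g] \<in> (square_ideal :: 'k::field free_algebra set)"
proof -
  have "{gen_alpha\<^sup>2, gen_beta\<^sup>2} \<subseteq> (square_ideal :: 'k free_algebra set)"
    unfolding square_ideal_def by (rule ring.genideal_self[OF ring_ring_of_type_algebra]) simp
  moreover have "monomial [g, g] = monomial [g] * (monomial [g] :: 'k free_algebra)"
    by (simp add: mult_single flip: word_append)
  ultimately show ?thesis
    by (cases g) (simp_all add: gen_alpha_def gen_beta_def power2_eq_square)
qed

lemma square_ideal_eq: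
  "(square_ideal :: 'k::field free_algebra set) =
     {x. \<forall>w\<in>Poly_Mapping.keys x. \<not> distinct_adj (letters w)}" (is "_ = ?J")
proof
  \<comment> \<open>The support of a product consists of concatenations, and a repeated adjacent
    letter in either factor survives concatenation.\<close>
  have mult: "x * y \<in> ?J" if "x \<in> ?J \<or> y \<in> ?J" for x y :: "'k free_algebra"
    using that keys_mult[of x y] by fastforce
  have "ideal ?J free_alg_ring"
  proof (intro idealI ring_ring_of_type_algebra group.subgroupI abelian_group.a_group
      ring.is_abelian_group)
    fix x y :: "'k free_algebra" assume "x \<in> ?J" "y \<in> ?J"
    then show "x \<otimes>\<^bsub>add_monoid free_alg_ring\<^esub> y \<in> ?J"
      using keys_add[of x y] by auto
  next
    fix x :: "'k free_algebra" assume "x \<in> ?J"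
    then show "inv\<^bsub>add_monoid free_alg_ring\<^esub> x \<in> ?J"
      using ring_of_type_algebra_a_inv[of x] by (simp add: a_inv_def)
  next
    fix x y :: "'k free_algebra" assume "x \<in> ?J"
    then show "y \<otimes>\<^bsub>free_alg_ring\<^esub> x \<in> ?J" "x \<otimes>\<^bsub>free_alg_ring\<^esub> y \<in> ?J"
      using mult[of x y] mult[of y x] by (simp_all only: ring_of_type_algebra_simps simp_thms)
  next
    have "0 \<in> ?J" by simp
    then show "?J \<noteq> {}" by blast
  qed simp
  moreover have "{gen_alpha\<^sup>2, gen_beta\<^sup>2} \<subseteq> ?J"
    by (simp add: gen_alpha_def gen_beta_def power2_eq_square mult_single)
  ultimately show "square_ideal \<subseteq> ?J"
    unfolding square_ideal_def by (rule ring.genideal_minimal[OF ring_ring_of_type_algebra])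
next
  interpret F: free_algebra_ideal "square_ideal :: 'k free_algebra set"
    by (rule free_algebra_ideal_square_ideal)
  show "?J \<subseteq> square_ideal"
  proof
    fix x :: "'k free_algebra" assume "x \<in> ?J"
    then show "x \<in> square_ideal"
    \<comment> \<open>Each step adds a monomial at a fresh word. Nothing cancels, so the condition
      on the support passes both to the new word and to the rest.\<close>
    proof (induction x rule: update_induct)
      case const
      show ?case using additive_subgroup.zero_closed[OF F.is_additive_subgroup] by simp
    next
      case (update x w c)
      have "w \<in> Poly_Mapping.keys (Poly_Mapping.update w c x)"
        using update.hyps by (simp add: keys_update)
      with update.prems have "\<not> distinct_adj (letters w)" by blast
      then obtain us g vs where w: "letters w = us @ [g, g] @ vs" by (rule not_distinct_adjE)
      \<comment> \<open>Splitting w at the repeated letter exhibits its monomial as a two-sided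
        multiple of a square.\<close>
      have "w = word us + word [g, g] + word vs"
        unfolding word_append[symmetric] append_assoc w[symmetric] by (simp add: letters_inverse)
      then have "Poly_Mapping.single w c =
          Poly_Mapping.single (word us) c * monomial [g, g] * monomial vs"
        by (simp add: mult_single)
      moreover have "Poly_Mapping.single (word us) c * monomial [g, g] \<in> square_ideal"
        using F.I_l_closed[OF square_mem_square_ideal] by simp
      then have "Poly_Mapping.single (word us) c * monomial [g, g] * monomial vs \<in> square_ideal"
        using F.I_r_closed by force
      ultimately have "Poly_Mapping.single w c \<in> square_ideal" by simp
      moreover have "x \<in> square_ideal"
        using update.hyps update.prems by (intro update.IH) (auto simp: keys_update)
      moreover have "Poly_Mapping.update w c x = x + Poly_Mapping.single w c"
        using update.hyps(1) by (rule update_eq_add_single)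
      ultimately show ?case
        using additive_subgroup.a_closed[OF F.is_additive_subgroup] by simp
    qed
  qed
qed

section \<open>Alternating words and powers of \<alpha>\<beta>\<close>

lemma gen_not_Beta: "g \<noteq> Beta \<longleftrightarrow> g = Alpha" and gen_not_Alpha: "g \<noteq> Alpha \<longleftrightarrow> g = Beta"
  by (cases g; simp)+

text \<open>Letters are removed in pairs: alternation forces the first two to be \<alpha>\<beta>,
  and a non-empty rest again begins with \<alpha> and ends with \<beta>.\<close>

lemma alternating_imp_alt_word:
  "\<lbrakk>distinct_adj w; w \<noteq> []; hd w = Alpha; last w = Beta\<rbrakk> \<Longrightarrow> \<exists>m. w = alt_word m"
proof (induction w rule: induct_list012)
  case (3 x y w)
  then have xy: "x = Alpha" "y = Beta" by (auto simp flip: gen_not_Alpha)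
  show ?case
  proof (cases w)
    case Nil
    then have "x # y # w = alt_word 1" by (simp add: xy alt_word_def)
    then show ?thesis ..
  next
    case (Cons z v)
    with 3 xy have "z = Alpha" by (auto simp flip: gen_not_Beta)
    with 3 Cons obtain m where "w = alt_word m" by (auto dest: distinct_adj_ConsD)
    then have "x # y # w = alt_word (Suc m)" by (simp add: xy alt_word_def)
    then show ?thesis ..
  qed
qed simp_all

text \<open>Both added words are non-empty even if w already has the right end letters. Thus s and t
  alone fix the ends of s v t for every v, not only for w.\<close>

lemma extend_alternating:
  assumes "distinct_adj w"
  obtains s t where "distinct_adj (s @ w @ t)" "s \<noteq> []" "hd s = Alpha" "t \<noteq> []" "last t = Beta"
proof
  let ?s = "if w \<noteq> [] \<and> hd w = Alpha then [Alpha, Beta] else [Alpha]"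
  let ?t = "if w \<noteq> [] \<and> last w = Beta then [Alpha, Beta] else [Beta]"
  show "distinct_adj (?s @ w @ ?t)"
    using assms by (cases "w = []") (auto simp: distinct_adj_append_iff)
qed auto

lemma alt_word_inject: "alt_word m = alt_word n \<longleftrightarrow> m = n"
proof
  have "length (alt_word m) = 2 * m" for m by (induction m) (simp_all add: alt_word_def)
  then show "alt_word m = alt_word n \<Longrightarrow> m = n" by (metis mult_cancel1 zero_neq_numeral)
qed simp

lemma word_inject: "word v = word w \<longleftrightarrow> v = w"
  by (metis UNIV_I word_inverse)

lemma lookup_poly_alpha_beta:
  "Poly_Mapping.lookup (poly_alpha_beta g) (word (alt_word m)) = Polynomial.coeff g m"
  by (auto simp: poly_alpha_beta_def lookup_sum lookup_single word_inject alt_word_inject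
      Polynomial.coeff_eq_0 when_def)

lemma keys_poly_alpha_beta:
  "w \<in> Poly_Mapping.keys (poly_alpha_beta g) \<Longrightarrow> \<exists>m. w = word (alt_word m)"
  unfolding poly_alpha_beta_def using keys_sum by (fastforce split: if_splits)

lemma alternating_alt_word: "distinct_adj (alt_word m)"
proof -
  \<comment> \<open>The first letter is carried along because it decides whether another
    \<alpha>\<beta> may be put in front.\<close>
  have "distinct_adj (alt_word m) \<and> (m > 0 \<longrightarrow> hd (alt_word m) = Alpha)"
    by (induction m) (auto simp: alt_word_def distinct_adj_Cons)
  then show ?thesis ..
qed

text \<open>Elements of the ideal have no alternating word in their support, while the coefficients
  of g sit exactly at the alternating words (\<alpha>\<beta>)^m.\<close>

lemma poly_alpha_beta_mem_square_ideal:
  assumes "poly_alpha_beta g \<in> square_ideal"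
  shows "g = 0"
proof (rule poly_eqI)
  fix m
  have "word (alt_word m) \<notin> Poly_Mapping.keys (poly_alpha_beta g)"
    using assms alternating_alt_word[of m] unfolding square_ideal_eq mem_Collect_eq
    by (metis letters_word)
  then show "Polynomial.coeff g m = Polynomial.coeff 0 m"
    by (simp add: in_keys_iff lookup_poly_alpha_beta)
qed

lemma sandwich_mem_poly_alpha_beta:
  fixes x :: "'k::field free_algebra"
  assumes "x \<notin> square_ideal"
  obtains g s t where "g \<noteq> 0" "monomial s * x * monomial t - poly_alpha_beta g \<in> square_ideal"
proof -
  obtain w0 where w0: "w0 \<in> Poly_Mapping.keys x" "distinct_adj (letters w0)"
    using assms by (auto simp: square_ideal_eq)
  obtain s t where st: "distinct_adj (s @ letters w0 @ t)"
      "s \<noteq> []" "hd s = Alpha" "t \<noteq> []" "last t = Beta"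
    using extend_alternating[OF w0(2)] by blast
  define y where "y = monomial s * x * monomial t"
  have alt: "\<exists>m. w = alt_word m" if "distinct_adj w" "w = s @ v @ t" for w v
    using that st by (intro alternating_imp_alt_word) auto
  have keys_y: "\<exists>m. w = word (alt_word m)"
    if w: "w \<in> Poly_Mapping.keys y" "distinct_adj (letters w)" for w
  proof -
    obtain v where "w = word s + v + word t"
      using w(1) keys_mult[of "monomial s * x" "monomial t"] keys_mult[of "monomial s" x]
      by (fastforce simp: y_def)
    then have "letters w = s @ letters v @ t" by simp
    with w(2) alt obtain m where "letters w = alt_word m" by blast
    then show ?thesis by (metis letters_inverse)
  qed
  \<comment> \<open>The coefficients of the desired g are those of y at the powers of
    \<alpha>\<beta>. Distinct powers are distinct words and y has finite support, so almost all of
    them vanish, which \<open>Abs_poly\<close> needs.\<close>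
  let ?c = "\<lambda>m. Poly_Mapping.lookup y (word (alt_word m))"
  have "inj (\<lambda>m. word (alt_word m))" by (simp add: inj_def word_inject alt_word_inject)
  then have "finite ((\<lambda>m. word (alt_word m)) -` Poly_Mapping.keys y)"
    by (intro finite_vimageI) simp_all
  then have "\<forall>\<^sub>\<infinity>m. ?c m = 0" by (simp add: MOST_iff_cofinite vimage_def in_keys_iff)
  then have coeff: "Polynomial.coeff (Abs_poly ?c) = ?c" by (simp add: Abs_poly_inverse)
  show thesis
  proof (rule that)
    \<comment> \<open>This coefficient of y equals that of x at \<open>w0\<close>. Its word is a
      power of \<alpha>\<beta>, so g has a non-zero coefficient.\<close>
    have "Poly_Mapping.lookup y (word s + w0 + word t) \<noteq> 0"
      using w0(1) by (simp add: y_def lookup_mult_monomial lookup_monomial_mult in_keys_iff)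
    moreover obtain m where "s @ letters w0 @ t = alt_word m" using alt st by blast
    then have "word s + w0 + word t = word (alt_word m)"
      by (metis letters_inverse word_append add.assoc)
    ultimately show "Abs_poly ?c \<noteq> 0" using coeff by (metis coeff_0)
    \<comment> \<open>Modulo the ideal only alternating words count, and by \<open>keys_y\<close>
      those in the support of y are powers of \<alpha>\<beta>.\<close>
    have "Poly_Mapping.lookup y w = Poly_Mapping.lookup (poly_alpha_beta (Abs_poly ?c)) w"
      if w: "distinct_adj (letters w)" for w
    proof (cases "\<exists>m. w = word (alt_word m)")
      case True
      then show ?thesis using coeff lookup_poly_alpha_beta by metis
    next
      case False
      then show ?thesis using keys_y w keys_poly_alpha_beta by (metis in_keys_iff)
    qed
    then show "monomial s * x * monomial t - poly_alpha_beta (Abs_poly ?c) \<in> square_ideal"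
      by (auto simp: square_ideal_eq in_keys_iff lookup_minus simp flip: y_def)
  qed
qed

text \<open>The kernel of \<open>subst\<close> is an ideal containing both generators, hence
  contains the ideal they generate.\<close>

lemma (in algebra_pair) subst_square_ideal:
  assumes "a \<otimes> a = \<zero>" "b \<otimes> b = \<zero>" "x \<in> square_ideal"
  shows "subst x = \<zero>"
proof -
  have "ideal (a_kernel free_alg_ring B subst) free_alg_ring"
    using ring_hom_ring_subst by (rule ring_hom_ring.kernel_is_ideal)
  moreover have "{gen_alpha\<^sup>2, gen_beta\<^sup>2} \<subseteq> a_kernel free_alg_ring B subst"
    using assms
    by (simp add: a_kernel_def' gen_alpha_def gen_beta_def power2_eq_square mult_single subst_single
        flip: word_append)
  ultimately have "square_ideal \<subseteq> a_kernel free_alg_ring B subst"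
    unfolding square_ideal_def by (rule ring.genideal_minimal[OF ring_ring_of_type_algebra])
  then show ?thesis using assms(3) by (auto simp: a_kernel_def')
qed

text \<open>Substituting the classes of the generators is the projection to the quotient, as both
  maps are linear and agree on words. Hence evaluating g at the class of \<alpha>\<beta> gives the
  class of \<open>poly_alpha_beta g\<close>.\<close>

lemma (in free_algebra_ideal) subst_cls:
  "algebra_pair.subst quot (cls (monomial [Alpha])) (cls (monomial [Beta])) x = cls x"
proof -
  interpret quot: unital_algebra quot by (rule unital_algebra_quot)
  interpret P: algebra_pair quot "cls (monomial [Alpha])" "cls (monomial [Beta])"
    by unfold_locales (simp_all add: cls_mem_carrier)
  have gen: "case_gen (cls (monomial [Alpha])) (cls (monomial [Beta])) g = cls (monomial [g])" for g
    by (cases g) simp_all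
  have val: "P.word_val w = cls (monomial w)" for w
    by (induction w) (simp_all add: cls_simps gen mult_single word_Nil flip: word_append)
  show ?thesis
  proof (induction x rule: poly_mapping_add_induct)
    case (single w c)
    show ?case by (subst (2) single_eq_scale) (simp add: P.subst_single val cls_simps letters_inverse)
  qed (simp_all add: P.subst_add cls_simps)
qed


section \<open>Laurent polynomial identities and the property \<open>P\<^sub>1\<close>\<close>

text \<open>The polynomial is extracted from one non-zero value of f on units of \<F>, before any B
  is considered.\<close>

lemma property_P1_if_not_LPI_algF:
  fixes f :: "'k::field laurent_poly"
  assumes "\<not> is_LPI f (algF :: ('k, 'k free_algebra set) module)"
  shows "\<exists>g :: 'k poly. g \<noteq> 0 \<and>
    (\<forall>B :: ('k, 'b) module. unital_algebra B \<and> is_LPI f B \<longrightarrow> property_P1 B g)"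
proof -
  obtain u where u: "\<And>i. u i \<in> Units (algF :: ('k, 'k free_algebra set) module)"
    and fu: "eval_laurent algF u f \<noteq> \<zero>\<^bsub>algF\<^esub>"
    using assms by (auto simp: is_LPI_def)
  interpret F: free_algebra_ideal "square_ideal :: 'k free_algebra set"
    by (rule free_algebra_ideal_square_ideal)
  interpret alg: unital_algebra F.quot by (rule F.unital_algebra_quot)
  have w: "eval_word F.quot u w \<in> carrier F.quot" for w
    by (rule alg.eval_word_closed) (use u in \<open>simp add: algF_eq\<close>)
  have "eval_laurent F.quot u f \<in> carrier F.quot"
    unfolding eval_laurent_def using w by (auto intro!: alg.finsum_closed)
  then obtain x where x: "eval_laurent F.quot u f = F.cls x"
    by (auto simp: F.carrier_quot)
  with fu have "x \<notin> square_ideal" by (simp add: algF_eq F.cls_eq_zero_iff)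
  then obtain g s t where g: "g \<noteq> 0" "monomial s * x * monomial t - poly_alpha_beta g \<in> square_ideal"
    by (rule sandwich_mem_poly_alpha_beta)
  have "property_P1 B g" if "unital_algebra B" "is_LPI f B" for B :: "('k, 'b) module"
    unfolding property_P1_def
  proof (intro ballI impI)
    fix a b
    assume ab: "a \<in> carrier B" "b \<in> carrier B"
      "a \<otimes>\<^bsub>B\<^esub> a = \<zero>\<^bsub>B\<^esub> \<and> b \<otimes>\<^bsub>B\<^esub> b = \<zero>\<^bsub>B\<^esub>"
    interpret B: unital_algebra B by fact
    interpret P: algebra_pair B a b using ab by unfold_locales
    interpret P: algebra_pair_ideal B a b square_ideal
      by unfold_locales (use ab P.subst_square_ideal in blast)
    interpret induced: unital_algebra_hom F.quot B P.induced
      by (rule P.induced_hom)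
    have units: "u i \<in> Units F.quot" for i using u by (simp add: algF_eq)
    have "P.subst x = eval_laurent B (P.induced \<circ> u) f"
      using induced.hom_eval_laurent[of u f] units by (simp add: x P.induced_cls)
    also have "\<dots> = \<zero>\<^bsub>B\<^esub>"
      using \<open>is_LPI f B\<close> units induced.hom_Units by (simp add: is_LPI_def)
    finally have "P.subst (monomial s * x * monomial t) = \<zero>\<^bsub>B\<^esub>"
      by (simp add: P.subst_mult)
    \<comment> \<open>The two arguments differ by an element of the ideal, which the substitution
      kills.\<close>
    moreover have "P.subst (monomial s * x * monomial t) = P.subst (poly_alpha_beta g)"
      using P.subst_add[of "monomial s * x * monomial t - poly_alpha_beta g" "poly_alpha_beta g"]
        P.subst_ideal[OF g(2)] by simp
    ultimately show "eval_poly_in B g (a \<otimes>\<^bsub>B\<^esub> b) = \<zero>\<^bsub>B\<^esub>"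
      by (simp add: P.subst_poly_alpha_beta)
  qed
  with g(1) show ?thesis by blast
qed

text \<open>The property is tested on the classes of \<alpha> and \<beta>: it puts
  g(\<alpha>\<beta>) into the ideal.\<close>

lemma property_P1_algF_imp_zero:
  assumes "property_P1 (algF :: ('k::field, 'k free_algebra set) module) g"
  shows "g = 0"
proof -
  interpret F: free_algebra_ideal "square_ideal :: 'k free_algebra set"
    by (rule free_algebra_ideal_square_ideal)
  interpret alg: unital_algebra "F.quot :: ('k, 'k free_algebra set) module"
    by (rule F.unital_algebra_quot)
  let ?a = "F.cls (monomial [Alpha]) :: 'k free_algebra set"
  let ?b = "F.cls (monomial [Beta]) :: 'k free_algebra set"
  interpret P: algebra_pair F.quot ?a ?b by unfold_locales (simp_all add: F.cls_mem_carrier)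
  have "?a \<otimes>\<^bsub>F.quot\<^esub> ?a = \<zero>\<^bsub>F.quot\<^esub>" "?b \<otimes>\<^bsub>F.quot\<^esub> ?b = \<zero>\<^bsub>F.quot\<^esub>"
    using square_mem_square_ideal
    by (simp_all add: F.cls_mult F.cls_eq_zero_iff mult_single flip: word_append)
  then have "eval_poly_in F.quot g (?a \<otimes>\<^bsub>F.quot\<^esub> ?b) = \<zero>\<^bsub>F.quot\<^esub>"
    using assms by (simp add: property_P1_def algF_eq)
  then have "F.cls (poly_alpha_beta g) = \<zero>\<^bsub>F.quot\<^esub>"
    by (simp flip: P.subst_poly_alpha_beta add: F.subst_cls)
  then show ?thesis by (simp add: F.cls_eq_zero_iff poly_alpha_beta_mem_square_ideal)
qed

text \<open>
  The subalgebra of \<open>B\<close> generated by \<open>a\<close> and \<open>b\<close> is a quotient of the free algebra, and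
  so has a copy with carrier in \<^typ>\<open>'k free_algebra set\<close>.
\<close>

lemma property_P1_transfer:
  fixes f :: "'k::field laurent_poly" and B :: "('k, 'b, 'm) module_scheme"
  assumes P1: "\<And>C :: ('k, 'k free_algebra set) module.
      unital_algebra C \<Longrightarrow> is_LPI f C \<Longrightarrow> property_P1 C g"
    and "unital_algebra B" "is_LPI f B"
  shows "property_P1 B g"
  unfolding property_P1_def
proof (intro ballI impI)
  fix a b
  assume ab: "a \<in> carrier B" "b \<in> carrier B"
    "a \<otimes>\<^bsub>B\<^esub> a = \<zero>\<^bsub>B\<^esub> \<and> b \<otimes>\<^bsub>B\<^esub> b = \<zero>\<^bsub>B\<^esub>"
  interpret B: unital_algebra B by fact
  interpret P: algebra_pair B a b using ab by unfold_locales
  \<comment> \<open>Dividing by the full kernel makes the induced map injective, so the identity f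
    descends from B to the quotient.\<close>
  let ?I = "a_kernel free_alg_ring B P.subst"
  have I: "x \<in> ?I \<longleftrightarrow> P.subst x = \<zero>\<^bsub>B\<^esub>" for x by (simp add: a_kernel_def')
  interpret Q: free_algebra_ideal ?I
    using P.ring_hom_ring_subst by (intro free_algebra_ideal.intro ring_hom_ring.kernel_is_ideal)
  interpret P: algebra_pair_ideal B a b ?I by unfold_locales (simp add: I)
  interpret induced: unital_algebra_hom Q.quot B P.induced
    by (rule P.induced_hom)
  let ?a = "Q.cls (monomial [Alpha])" and ?b = "Q.cls (monomial [Beta])"
  have ind: "P.induced ?a = a" "P.induced ?b = b"
    using ab by (simp_all add: P.induced_cls P.subst_single B.smult_one[simplified])
  have "inj_on P.induced (carrier Q.quot)"
  proof (rule inj_onI)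
    fix S T assume ST: "S \<in> carrier Q.quot" "T \<in> carrier Q.quot" "P.induced S = P.induced T"
    then obtain x y where xy: "S = Q.cls x" "T = Q.cls y" by (auto simp: Q.carrier_quot)
    have "P.subst x = P.subst (x - y) \<oplus>\<^bsub>B\<^esub> P.subst y" using P.subst_add[of "x - y" y] by simp
    with ST xy have "P.subst (x - y) = \<zero>\<^bsub>B\<^esub>" by (simp add: P.induced_cls)
    then show "S = T" by (simp add: xy Q.cls_eq_iff I)
  qed
  then have "property_P1 Q.quot g"
    using P1 Q.unital_algebra_quot induced.is_LPI_of_inj \<open>is_LPI f B\<close> by blast
  moreover have "?a \<otimes>\<^bsub>Q.quot\<^esub> ?a = \<zero>\<^bsub>Q.quot\<^esub>" "?b \<otimes>\<^bsub>Q.quot\<^esub> ?b = \<zero>\<^bsub>Q.quot\<^esub>"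
    using ab ind by (simp_all add: Q.cls_mult Q.cls_eq_zero_iff I P.subst_mult P.induced_cls)
  ultimately have "eval_poly_in Q.quot g (?a \<otimes>\<^bsub>Q.quot\<^esub> ?b) = \<zero>\<^bsub>Q.quot\<^esub>"
    by (simp add: property_P1_def Q.cls_mem_carrier)
  \<comment> \<open>The induced homomorphism carries the relation back to B, where the two classes
    become a and b.\<close>
  then have "P.induced (eval_poly_in Q.quot g (?a \<otimes>\<^bsub>Q.quot\<^esub> ?b)) = \<zero>\<^bsub>B\<^esub>"
    by simp
  then show "eval_poly_in B g (a \<otimes>\<^bsub>B\<^esub> b) = \<zero>\<^bsub>B\<^esub>"
    using induced.hom_eval_poly_in[of "?a \<otimes>\<^bsub>Q.quot\<^esub> ?b" g]
    by (simp add: Q.cls_mem_carrier ind)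
qed

theorem lemma1p3:
  fixes f :: "'k::field laurent_poly"
  shows "(\<not> is_LPI f (algF :: ('k, 'k free_algebra set) module) \<longleftrightarrow>
      (\<exists>g :: 'k poly. g \<noteq> 0 \<and>
        (\<forall>B :: ('k, 'k free_algebra set) module.
           unital_algebra B \<and> is_LPI f B \<longrightarrow> property_P1 B g)))
    \<and> (\<forall>g :: 'k poly.
        (\<forall>B :: ('k, 'k free_algebra set) module.
           unital_algebra B \<and> is_LPI f B \<longrightarrow> property_P1 B g) \<longrightarrow>
        (\<forall>B :: ('k, 'b) module.
           unital_algebra B \<and> is_LPI f B \<longrightarrow> property_P1 B g))"
proof (intro conjI)
  \<comment> \<open>From right to left: if f were an identity for \<open>algF\<close>, then
    \<open>algF\<close> would itself be an admissible B, forcing g = 0.\<close>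
  show "\<not> is_LPI f (algF :: ('k, 'k free_algebra set) module) \<longleftrightarrow>
      (\<exists>g :: 'k poly. g \<noteq> 0 \<and>
        (\<forall>B :: ('k, 'k free_algebra set) module.
           unital_algebra B \<and> is_LPI f B \<longrightarrow> property_P1 B g))"
    using property_P1_if_not_LPI_algF property_P1_algF_imp_zero unital_algebra_algF by blast
  show "\<forall>g :: 'k poly.
        (\<forall>B :: ('k, 'k free_algebra set) module.
           unital_algebra B \<and> is_LPI f B \<longrightarrow> property_P1 B g) \<longrightarrow>
        (\<forall>B :: ('k, 'b) module.
           unital_algebra B \<and> is_LPI f B \<longrightarrow> property_P1 B g)"
    using property_P1_transfer by blast
qed

end
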